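(* Let $\mu_1,\mu_2$ be sub-distributions over countable sets $A_1,A_2$, let $R\subseteq A_1\times A_2$, and let $\varepsilon,\delta$ be reals. There exists a sub-distribution $\mu$ over $A_1\times A_2$ with $\pi_1(\mu)\le\mu_1$, $\pi_2(\mu)\le\mu_2$ (pointwise), $\mathrm{supp}(\mu)\subseteq R$, $d_\varepsilon(\mu_1,\pi_1(\mu))\le\delta$ and $d_\varepsilon(\mu_2,\pi_2(\mu))\le\delta$, if and only if there is a symmetric $(\varepsilon,\delta)$-approximate lifting of $R$ relating $\mu_1$ and $\mu_2$.
   Context: A sub-distribution over a countable set $A$ is $\mu:A\to[0,1]$ with $\sum_a\mu(a)\le1$; $\mu(X)=\sum_{a\in X}\mu(a)$. Marginals of $\mu$ over $A_1\times A_2$ are $\pi_1(\mu)(a_1)=\sum_{a_2}\mu(a_1,a_2)$, $\pi_2(\mu)(a_2)=\sum_{a_1}\mu(a_1,a_2)$. $d_\varepsilon(\nu_1,\nu_2)=\max_{X}(\nu_1(X)-e^{\varepsilon}\nu_2(X))$. With a fresh element $\star$, $A^\star=A\cup\{\star\}$ and $R^\star=R\cup(A_1\times\{\star\})\cup(\{\star\}\times A_2)$. A symmetric $(\varepsilon,\delta)$-approximate $R$-lifting of $(\mu_1,\mu_2)$ exists if there are sub-distributions $\mu_L,\mu_R$ over $A_1^\star\times A_2^\star$ with $\pi_1(\mu_L)=\mu_1$, $\pi_2(\mu_R)=\mu_2$ (with $\mu_i(\star)=0$), $\mathrm{supp}(\mu_L)\cup\mathrm{supp}(\mu_R)\subseteq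 R^\star$, $d_\varepsilon(\mu_L,\mu_R)\le\delta$ and $d_\varepsilon(\mu_R,\mu_L)\le\delta$.
   Formalization: The formal theorem assumes ε ≥ 0 instead of an arbitrary real ε; for ε < 0 the equivalence fails (e^ε = 1/2, R the diagonal on two points, μ1 = (1/4,1/2), μ2 = (1/2,1/4), δ = 3/8). *)

theory Defs
  imports "HOL-Probability.Probability"
begin

text \<open>
  A sub-distribution over a countable set \<open>A\<close> is an element \<open>\<mu>\<close> of the library type
  \<open>'a spmf\<close> with \<open>set_spmf \<mu> \<subseteq> A\<close>: the value of \<open>\<mu>\<close> at \<open>a\<close> is \<open>spmf \<mu> a\<close>, its support is
  \<open>set_spmf \<mu>\<close>, and \<open>\<mu>(X)\<close> is \<open>measure (measure_spmf \<mu>) X\<close>.  Its marginals are the push-forwards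
  \<open>map_spmf fst \<mu>\<close> and \<open>map_spmf snd \<mu>\<close>.  The first three lemmas below confirm that these are
  the usual sums.
\<close>

lemma measure_spmf_eq_infsum:
  "measure (measure_spmf \<mu>) X = (\<Sum>\<^sub>\<infinity>a\<in>X. spmf \<mu> a)"
proof -
  have "measure (measure_spmf \<mu>) X = measure (measure_pmf \<mu>) (Some ` X)"
    by (simp add: measure_measure_spmf_conv_measure_pmf)
  also have "\<dots> = infsetsum (pmf \<mu>) (Some ` X)"
    by (rule measure_pmf_conv_infsetsum)
  also have "\<dots> = infsetsum (\<lambda>a. spmf \<mu> a) X"
    by (subst infsetsum_reindex) auto
  also have "\<dots> = (\<Sum>\<^sub>\<infinity>a\<in>X. spmf \<mu> a)"
  proof (rule infsetsum_infsum)
    have "Infinite_Set_Sum.abs_summable_on (pmf \<mu>) (Some ` X)"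
      by (rule pmf_abs_summable)
    then show "Infinite_Set_Sum.abs_summable_on (spmf \<mu>) X"
      by (subst (asm) abs_summable_on_reindex_iff[symmetric]) auto
  qed
  finally show ?thesis .
qed

lemma spmf_map_fst_eq_infsum:
  "spmf (map_spmf fst \<mu>) a = (\<Sum>\<^sub>\<infinity>b. spmf \<mu> (a, b))"
proof -
  have eq: "fst -` {a} = Pair a ` UNIV" by auto
  have "spmf (map_spmf fst \<mu>) a = (\<Sum>\<^sub>\<infinity>z\<in>fst -` {a}. spmf \<mu> z)"
    by (simp add: spmf_map measure_spmf_eq_infsum)
  also have "\<dots> = (\<Sum>\<^sub>\<infinity>b. spmf \<mu> (a, b))"
    unfolding eq by (subst infsum_reindex) (auto simp: inj_on_def o_def)
  finally show ?thesis .
qed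

lemma spmf_map_snd_eq_infsum:
  "spmf (map_spmf snd \<mu>) b = (\<Sum>\<^sub>\<infinity>a. spmf \<mu> (a, b))"
proof -
  have eq: "snd -` {b} = (\<lambda>a. (a, b)) ` UNIV" by auto
  have "spmf (map_spmf snd \<mu>) b = (\<Sum>\<^sub>\<infinity>z\<in>snd -` {b}. spmf \<mu> z)"
    by (simp add: spmf_map measure_spmf_eq_infsum)
  also have "\<dots> = (\<Sum>\<^sub>\<infinity>a. spmf \<mu> (a, b))"
    unfolding eq by (subst infsum_reindex) (auto simp: inj_on_def o_def)
  finally show ?thesis .
qed

text \<open>
  \<open>X\<close> ranges over all sets of the type; elements outside the support contribute nothing, so
  this agrees with letting \<open>X\<close> range over the subsets of the carrier.  The supremum is a maximum,
  see \<open>dp_div_attained\<close>.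
\<close>

definition dp_div :: "real \<Rightarrow> 'a spmf \<Rightarrow> 'a spmf \<Rightarrow> real" where
  "dp_div \<epsilon> \<nu>1 \<nu>2 =
     (SUP X. measure (measure_spmf \<nu>1) X - exp \<epsilon> * measure (measure_spmf \<nu>2) X)"

lemma dp_div_attained:
  fixes \<epsilon> :: real and \<nu>1 \<nu>2 :: "'a spmf" and A :: "'a set"
  assumes "set_spmf \<nu>1 \<subseteq> A"
  obtains X where "X \<subseteq> A"
    and "dp_div \<epsilon> \<nu>1 \<nu>2 = measure (measure_spmf \<nu>1) X - exp \<epsilon> * measure (measure_spmf \<nu>2) X"
    and "\<And>Y. measure (measure_spmf \<nu>1) Y - exp \<epsilon> * measure (measure_spmf \<nu>2) Y
           \<le> measure (measure_spmf \<nu>1) X - exp \<epsilon> * measure (measure_spmf \<nu>2) X"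
proof -
  let ?d = "\<lambda>X. measure (measure_spmf \<nu>1) X - exp \<epsilon> * measure (measure_spmf \<nu>2) X"
  define f where "f a = spmf \<nu>1 a - exp \<epsilon> * spmf \<nu>2 a" for a
  define X where "X = {a. f a > 0}"
  have s: "spmf \<mu> summable_on Y" for \<mu> :: "'a spmf" and Y
  proof -
    have "Infinite_Set_Sum.abs_summable_on (pmf \<mu>) (Some ` Y)"
      by (rule pmf_abs_summable)
    then have "Infinite_Set_Sum.abs_summable_on (spmf \<mu>) Y"
      by (subst (asm) abs_summable_on_reindex_iff[symmetric]) auto
    then show ?thesis
      using abs_summable_equivalent abs_summable_summable by blast
  qed
  have d: "(f has_sum ?d Y) Y" for Y
  proof -
    have h: "(spmf \<mu> has_sum measure (measure_spmf \<mu>) Y) Y" for \<mu> :: "'a spmf"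
      by (simp add: measure_spmf_eq_infsum s)
    have "((\<lambda>a. spmf \<nu>1 a + (- exp \<epsilon>) * spmf \<nu>2 a) has_sum
        measure (measure_spmf \<nu>1) Y + (- exp \<epsilon>) * measure (measure_spmf \<nu>2) Y) Y"
      by (intro has_sum_add has_sum_cmult_right h)
    then show ?thesis by (simp add: f_def[abs_def])
  qed
  have mx: "?d Y \<le> ?d X" for Y
    by (rule has_sum_mono_neutral[OF d d]) (auto simp: X_def not_less)
  have "X \<subseteq> A"
  proof
    fix a assume "a \<in> X"
    then have "spmf \<nu>1 a > exp \<epsilon> * spmf \<nu>2 a" by (simp add: X_def f_def)
    moreover have "exp \<epsilon> * spmf \<nu>2 a \<ge> 0" by simp
    ultimately have "spmf \<nu>1 a \<noteq> 0" by linarith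
    then show "a \<in> A" using assms by (auto simp: in_set_spmf_iff_spmf)
  qed
  moreover have "dp_div \<epsilon> \<nu>1 \<nu>2 = ?d X"
    unfolding dp_div_def by (rule cSup_eq_maximum) (auto intro: mx)
  ultimately show thesis using mx that by blast
qed

text \<open>The fresh element \<open>\<star>\<close> is \<open>None\<close>.\<close>

definition star_set :: "'a set \<Rightarrow> 'a option set" where
  "star_set A = insert None (Some ` A)"

definition star_rel ::
    "'a set \<Rightarrow> 'b set \<Rightarrow> ('a \<times> 'b) set \<Rightarrow> ('a option \<times> 'b option) set" where
  "star_rel A1 A2 R =
     (\<lambda>(a, b). (Some a, Some b)) ` R \<union> (Some ` A1) \<times> {None} \<union> {None} \<times> (Some ` A2)"

text \<open>
  \<open>map_spmf Some \<mu>\<close> is the extension of \<open>\<mu>\<close> to the starred carrier with value \<open>0\<close> at \<open>None\<close>.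
\<close>

definition symmetric_lifting ::
    "'a set \<Rightarrow> 'b set \<Rightarrow> real \<Rightarrow> real \<Rightarrow> ('a \<times> 'b) set \<Rightarrow> 'a spmf \<Rightarrow> 'b spmf \<Rightarrow> bool" where
  "symmetric_lifting A1 A2 \<epsilon> \<delta> R \<mu>1 \<mu>2 \<longleftrightarrow>
     (\<exists>(\<mu>L :: ('a option \<times> 'b option) spmf) (\<mu>R :: ('a option \<times> 'b option) spmf).
        set_spmf \<mu>L \<subseteq> star_set A1 \<times> star_set A2 \<and>
        set_spmf \<mu>R \<subseteq> star_set A1 \<times> star_set A2 \<and>
        map_spmf fst \<mu>L = map_spmf Some \<mu>1 \<and>
        map_spmf snd \<mu>R = map_spmf Some \<mu>2 \<and>
        set_spmf \<mu>L \<union> set_spmf \<mu>R \<subseteq> star_rel A1 A2 R \<and>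
        dp_div \<epsilon> \<mu>L \<mu>R \<le> \<delta> \<and>
        dp_div \<epsilon> \<mu>R \<mu>L \<le> \<delta>)"

text \<open>
  \<open>\<epsilon> \<ge> 0\<close> cannot be dropped from the characterization by a single witness.  Take
  \<open>exp \<epsilon> = 1/2\<close>, two-point carriers, \<open>R\<close> the diagonal, \<open>\<mu>1 = (1/4, 1/2)\<close>, \<open>\<mu>2 = (1/2, 1/4)\<close>
  and \<open>\<delta> = 3/8\<close>.  Placing \<open>\<mu>1\<close> and \<open>\<mu>2\<close> on the diagonal gives a symmetric lifting.  A witness
  \<open>\<mu>\<close> has mass at most \<open>1/4\<close> at each diagonal point, so the divergence of \<open>\<mu>1\<close> from its first
  marginal is at least \<open>3/4 - 1/2 * 1/2 = 1/2\<close>.  No sign condition on \<open>\<delta>\<close> is needed: \<open>dp_div\<close> is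
  nonnegative (take \<open>X\<close> empty), so for \<open>\<delta> < 0\<close> both sides are false.
\<close>

end

theory Submission
  imports Defs
begin

text \<open>
  Write \<open>c = exp \<epsilon>\<close>. From a lifting \<open>(\<mu>L, \<mu>R)\<close> one obtains a witness as the pointwise minimum of
  \<open>\<mu>L\<close> and \<open>\<mu>R\<close>: the stars disappear because \<open>\<mu>L\<close> vanishes on \<open>(\<star>, b)\<close> and \<open>\<mu>R\<close> on \<open>(a, \<star>)\<close>, and
  \<open>\<mu>L - c min(\<mu>L, \<mu>R) \<le> max 0 (\<mu>L - c \<mu>R)\<close> as \<open>c \<ge> 1\<close>. Conversely, let \<open>\<mu>\<close> be a witness with first
  marginal \<open>p\<close>. Multiply each row \<open>a\<close> of \<open>\<mu>\<close> by \<open>min c (\<mu>1 a / p a)\<close> and send the mass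
  \<open>max 0 (\<mu>1 a - c p a)\<close> that is still missing to \<open>(a, \<star>)\<close>. This gives \<open>\<mu>L\<close> with first marginal \<open>\<mu>1\<close>,
  lying between \<open>\<mu>\<close> and \<open>c \<mu>\<close> off the star column; \<open>\<mu>R\<close> is obtained symmetrically from the columns.
\<close>

section \<open>Sums and push-forwards of sub-distributions\<close>

lemma spmf_summable_on: "spmf \<mu> summable_on X"
proof -
  have "Infinite_Set_Sum.abs_summable_on (pmf \<mu>) (Some ` X)"
    by (rule pmf_abs_summable)
  then have "Infinite_Set_Sum.abs_summable_on (spmf \<mu>) X"
    by (subst (asm) abs_summable_on_reindex_iff[symmetric]) auto
  then show ?thesis
    using abs_summable_equivalent abs_summable_summable by blast
qed

lemma spmf_has_sum_measure: "(spmf \<mu> has_sum measure (measure_spmf \<mu>) X) X"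
  by (simp add: measure_spmf_eq_infsum spmf_summable_on)

lemma spmf_diff_has_sum:
  "((\<lambda>z. spmf \<nu>1 z - c * spmf \<nu>2 z) has_sum
     (measure (measure_spmf \<nu>1) X - c * measure (measure_spmf \<nu>2) X)) X"
proof -
  have "((\<lambda>z. spmf \<nu>1 z + (- c) * spmf \<nu>2 z) has_sum
      (measure (measure_spmf \<nu>1) X + (- c) * measure (measure_spmf \<nu>2) X)) X"
    by (intro has_sum_add has_sum_cmult_right spmf_has_sum_measure)
  then show ?thesis by simp
qed

lemma spmf_map_mono:
  assumes "\<And>z. spmf \<mu> z \<le> spmf \<nu> z"
  shows "spmf (map_spmf f \<mu>) x \<le> spmf (map_spmf f \<nu>) x"
  unfolding spmf_map by (rule has_sum_mono[OF spmf_has_sum_measure spmf_has_sum_measure assms])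

lemma set_spmf_mono:
  assumes "\<And>z. spmf \<mu> z \<le> spmf \<nu> z"
  shows "set_spmf \<mu> \<subseteq> set_spmf \<nu>"
proof
  fix z assume "z \<in> set_spmf \<mu>"
  then have "0 < spmf \<mu> z" by (simp add: in_set_spmf_iff_spmf order_less_le)
  then show "z \<in> set_spmf \<nu>"
    using assms[of z] by (simp add: in_set_spmf_iff_spmf)
qed

lemma map_spmf_the_Some: "map_spmf the (map_spmf Some \<mu>) = \<mu>"
  by (simp add: spmf.map_comp o_def)

section \<open>Bounds on the divergence\<close>

lemma dp_div_upper:
  "measure (measure_spmf \<nu>1) X - exp \<epsilon> * measure (measure_spmf \<nu>2) X \<le> dp_div \<epsilon> \<nu>1 \<nu>2"
  by (rule dp_div_attained[of \<nu>1 UNIV \<epsilon> \<nu>2]) auto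

lemma dp_div_leI:
  assumes "\<And>X. measure (measure_spmf \<nu>1) X - exp \<epsilon> * measure (measure_spmf \<nu>2) X \<le> d"
  shows "dp_div \<epsilon> \<nu>1 \<nu>2 \<le> d"
  unfolding dp_div_def by (rule cSUP_least) (auto intro: assms)

text \<open>Data processing: a set \<open>X\<close> has, under the push-forwards, the mass of its
  preimage under \<open>f\<close>, and preimages are only some of the competing sets.\<close>

lemma dp_div_map_le: "dp_div \<epsilon> (map_spmf f \<nu>1) (map_spmf f \<nu>2) \<le> dp_div \<epsilon> \<nu>1 \<nu>2"
  by (rule dp_div_leI) (simp add: measure_map_spmf dp_div_upper)

text \<open>The divergence is the sum of the positive parts of the pointwise differences, so
  comparing positive parts suffices. Within \<open>X\<close>, points outside \<open>?W\<close>
  contribute at most 0 on the left and are dropped.\<close>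

lemma dp_div_mono_pos_part:
  assumes "\<And>z. spmf \<nu>1 z - exp \<epsilon> * spmf \<nu>2 z \<le> max 0 (spmf \<rho>1 z - exp \<epsilon> * spmf \<rho>2 z)"
  shows "dp_div \<epsilon> \<nu>1 \<nu>2 \<le> dp_div \<epsilon> \<rho>1 \<rho>2"
proof (rule dp_div_leI)
  fix X
  let ?W = "{z \<in> X. 0 < spmf \<rho>1 z - exp \<epsilon> * spmf \<rho>2 z}"
  have "measure (measure_spmf \<nu>1) X - exp \<epsilon> * measure (measure_spmf \<nu>2) X
      \<le> measure (measure_spmf \<rho>1) ?W - exp \<epsilon> * measure (measure_spmf \<rho>2) ?W"
    by (rule has_sum_mono_neutral[OF spmf_diff_has_sum spmf_diff_has_sum])
      (use assms in \<open>force simp: max_def split: if_splits\<close>)+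
  also have "\<dots> \<le> dp_div \<epsilon> \<rho>1 \<rho>2" by (rule dp_div_upper)
  finally show "measure (measure_spmf \<nu>1) X - exp \<epsilon> * measure (measure_spmf \<nu>2) X
      \<le> dp_div \<epsilon> \<rho>1 \<rho>2" .
qed

text \<open>Passing from any set to \<open>W\<close> drops only nonpositive terms and adds only
  nonnegative ones.\<close>

lemma dp_div_le_on:
  assumes "\<And>z. z \<in> W \<Longrightarrow> exp \<epsilon> * spmf \<nu>2 z \<le> spmf \<nu>1 z"
    and "\<And>z. z \<notin> W \<Longrightarrow> spmf \<nu>1 z \<le> exp \<epsilon> * spmf \<nu>2 z"
  shows "dp_div \<epsilon> \<nu>1 \<nu>2 \<le> measure (measure_spmf \<nu>1) W - exp \<epsilon> * measure (measure_spmf \<nu>2) W"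
  by (rule dp_div_leI, rule has_sum_mono_neutral[OF spmf_diff_has_sum spmf_diff_has_sum])
    (use assms in auto)

section \<open>Completing rows to a prescribed first marginal\<close>

lemma ennreal_spmf_map_fst:
  "ennreal (spmf (map_spmf fst \<mu>) x) = (\<integral>\<^sup>+ y. ennreal (spmf \<mu> (x, y)) \<partial>count_space UNIV)"
proof -
  have "bij_betw (Pair x) UNIV (fst -` {x})"
    by (auto simp: bij_betw_def inj_on_def)
  then have "(\<integral>\<^sup>+ y. ennreal (spmf \<mu> (x, y)) \<partial>count_space UNIV) =
      (\<integral>\<^sup>+ z. ennreal (spmf \<mu> z) \<partial>count_space (fst -` {x}))"
    by (rule nn_integral_bij_count_space)
  then show ?thesis by (simp add: nn_integral_spmf ennreal_spmf_map)
qed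

text \<open>By Tonelli the total mass of \<open>f\<close> is the weight of \<open>p\<close>, hence
  at most 1, which is what \<open>embed_spmf\<close> needs to return \<open>f\<close>
  itself.\<close>

lemma embed_spmf_with_fst_marginal:
  fixes f :: "'a \<times> 'b \<Rightarrow> real" and p :: "'a spmf"
  assumes nonneg: "\<And>z. 0 \<le> f z"
    and row: "\<And>x. (\<integral>\<^sup>+ y. ennreal (f (x, y)) \<partial>count_space UNIV) = ennreal (spmf p x)"
  obtains L where "\<And>z. spmf L z = f z" and "map_spmf fst L = p"
proof
  have "(\<integral>\<^sup>+ z. ennreal (f z) \<partial>count_space UNIV) =
      (\<integral>\<^sup>+ x. \<integral>\<^sup>+ y. ennreal (f (x, y)) \<partial>count_space UNIV \<partial>count_space UNIV)"
    by (rule nn_integral_fst_count_space[symmetric])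
  also have "\<dots> = ennreal (weight_spmf p)"
    by (simp add: row weight_spmf_eq_nn_integral_spmf)
  also have "\<dots> \<le> 1" by (simp add: weight_spmf_le_1)
  finally have le_1: "(\<integral>\<^sup>+ z. ennreal (f z) \<partial>count_space UNIV) \<le> 1" .
  show *: "spmf (embed_spmf f) z = f z" for z
    using le_1 nonneg by (simp add: max_def)
  show "map_spmf fst (embed_spmf f) = p"
  proof (rule spmf_eqI)
    fix x
    have "ennreal (spmf (map_spmf fst (embed_spmf f)) x) =
        (\<integral>\<^sup>+ y. ennreal (spmf (embed_spmf f) (x, y)) \<partial>count_space UNIV)"
      by (rule ennreal_spmf_map_fst)
    then show "spmf (map_spmf fst (embed_spmf f)) x = spmf p x" by (simp add: * row)
  qed
qed

text \<open>The construction behind one side of a lifting, with \<open>y0\<close> in the role of the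
  star. \<open>L\<close> exceeds \<open>c * \<nu>\<close> only on full rows, so the excess is
  already visible in the first marginals.\<close>

lemma complete_rows:
  fixes \<nu> :: "('a \<times> 'b) spmf" and p :: "'a spmf" and y0 :: 'b
  assumes le: "\<And>x. spmf (map_spmf fst \<nu>) x \<le> spmf p x" and "\<epsilon> \<ge> 0"
  obtains L :: "('a \<times> 'b) spmf"
  where "map_spmf fst L = p"
    and "\<And>z. spmf \<nu> z \<le> spmf L z"
    and "set_spmf L \<subseteq> set_spmf \<nu> \<union> set_spmf p \<times> {y0}"
    and "dp_div \<epsilon> L \<nu> \<le> dp_div \<epsilon> p (map_spmf fst \<nu>)"
proof -
  define c where "c = exp \<epsilon>"
  have c: "1 \<le> c" using \<open>\<epsilon> \<ge> 0\<close> by (simp add: c_def)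
  define q where "q = map_spmf fst \<nu>"
  \<comment> \<open>Where \<open>spmf q x = 0\<close> the quotient is 0 by convention, so
    \<open>k x = 0\<close>. This is harmless: such a row of \<nu> vanishes and \<open>r x\<close>
    supplies all of \<open>spmf p x\<close>.\<close>
  define k where "k x = min c (spmf p x / spmf q x)" for x
  define r where "r x = max 0 (spmf p x - c * spmf q x)" for x
  define f where "f z = k (fst z) * spmf \<nu> z + r (fst z) * indicator {y0} (snd z)" for z
  have qp: "spmf q x \<le> spmf p x" for x using le by (simp add: q_def)
  have \<nu>q: "spmf \<nu> (x, y) \<le> spmf q x" for x y
  proof -
    have "measure (measure_spmf \<nu>) {(x, y)} \<le> measure (measure_spmf \<nu>) (fst -` {x})"
      by (rule measure_spmf.finite_measure_mono) auto
    then show ?thesis by (simp add: q_def measure_map_spmf spmf_conv_measure_spmf)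
  qed
  have k0: "0 \<le> k x" for x using c by (simp add: k_def)
  have r0: "0 \<le> r x" for x by (simp add: r_def)
  \<comment> \<open>For \<open>q x > 0\<close> the scaled row has mass
    \<open>min (c * q x) (p x)\<close>, and \<open>r x\<close> is exactly the shortfall from
    \<open>p x\<close>.\<close>
  have kr: "k x * spmf q x + r x = spmf p x" for x
  proof (cases "spmf q x = 0")
    case True
    then show ?thesis by (simp add: r_def)
  next
    case False
    then have "0 < spmf q x" by (simp add: order_less_le)
    then show ?thesis by (auto simp: k_def r_def min_def max_def field_simps)
  qed
  have row: "(\<integral>\<^sup>+ y. ennreal (f (x, y)) \<partial>count_space UNIV) = ennreal (spmf p x)" for x
  proof -
    have "(\<integral>\<^sup>+ y. ennreal (f (x, y)) \<partial>count_space UNIV) =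
        (\<integral>\<^sup>+ y. ennreal (k x) * ennreal (spmf \<nu> (x, y)) + ennreal (r x) * indicator {y0} y
          \<partial>count_space UNIV)"
      by (intro nn_integral_cong)
        (simp add: f_def k0 r0 ennreal_plus ennreal_mult split: split_indicator)
    also have "\<dots> = ennreal (k x) * ennreal (spmf q x) + ennreal (r x)"
      by (simp add: nn_integral_add nn_integral_cmult q_def ennreal_spmf_map_fst
          nn_integral_cmult_indicator)
    also have "\<dots> = ennreal (spmf p x)"
      using k0 r0 by (simp flip: kr add: ennreal_plus ennreal_mult)
    finally show ?thesis .
  qed
  have "0 \<le> f z" for z by (simp add: f_def k0 r0)
  then obtain L where L: "\<And>z. spmf L z = f z" and marg: "map_spmf fst L = p"
    using embed_spmf_with_fst_marginal row by metis
  \<comment> \<open>On nonzero rows \<open>k x\<close> is at least 1, since both \<open>c\<close>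
    and the ratio of \<open>p\<close> to \<open>q\<close> are.\<close>
  have k\<nu>: "spmf \<nu> (x, y) \<le> k x * spmf \<nu> (x, y)" for x y
  proof (cases "spmf q x = 0")
    case True
    then show ?thesis using \<nu>q[of x y] by simp
  next
    case False
    then have "0 < spmf q x" by (simp add: order_less_le)
    then have "1 \<le> k x" using c qp[of x] by (simp add: k_def)
    then show ?thesis using mult_right_mono[of 1 "k x" "spmf \<nu> (x, y)"] by simp
  qed
  have mono: "spmf \<nu> z \<le> spmf L z" for z
    using k\<nu>[of "fst z" "snd z"] r0[of "fst z"] by (simp add: L f_def add_increasing2)
  have supp: "set_spmf L \<subseteq> set_spmf \<nu> \<union> set_spmf p \<times> {y0}"
  proof
    fix z assume z: "z \<in> set_spmf L"
    then have "fst z \<in> set_spmf p" by (simp flip: marg)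
    moreover have "f z \<noteq> 0" using z by (simp add: in_set_spmf_iff_spmf L)
    ultimately show "z \<in> set_spmf \<nu> \<union> set_spmf p \<times> {y0}"
      by (cases z) (auto simp: f_def in_set_spmf_iff_spmf split: split_indicator_asm)
  qed
  \<comment> \<open>\<open>Y\<close> collects the rows where even the factor \<open>c\<close> leaves
    mass missing. There \<open>L\<close> is \<open>c * \<nu>\<close> plus the leftover at
    \<open>y0\<close>; on other rows nothing is added and the factor is at most
    \<open>c\<close>.\<close>
  define Y where "Y = {x. c * spmf q x < spmf p x}"
  have up: "exp \<epsilon> * spmf \<nu> z \<le> spmf L z" if "z \<in> fst -` Y" for z
  proof -
    obtain x y where z: "z = (x, y)" by force
    have "c * spmf \<nu> (x, y) \<le> k x * spmf \<nu> (x, y)"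
    proof (cases "spmf q x = 0")
      case True
      then show ?thesis using \<nu>q[of x y] by simp
    next
      case False
      then have "0 < spmf q x" by (simp add: order_less_le)
      then have "k x = c" using that by (simp add: k_def Y_def z field_simps min_def)
      then show ?thesis by simp
    qed
    then show ?thesis using r0[of x] by (simp add: L f_def z c_def add_increasing2)
  qed
  have down: "spmf L z \<le> exp \<epsilon> * spmf \<nu> z" if "z \<notin> fst -` Y" for z
    using that by (simp add: L f_def Y_def r_def k_def c_def mult_right_mono)
  have "dp_div \<epsilon> L \<nu> \<le>
      measure (measure_spmf L) (fst -` Y) - exp \<epsilon> * measure (measure_spmf \<nu>) (fst -` Y)"
    by (rule dp_div_le_on[OF up down])
  also have "\<dots> = measure (measure_spmf p) Y - exp \<epsilon> * measure (measure_spmf q) Y"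
    by (simp add: q_def measure_map_spmf flip: marg)
  also have "\<dots> \<le> dp_div \<epsilon> p q" by (rule dp_div_upper)
  finally have "dp_div \<epsilon> L \<nu> \<le> dp_div \<epsilon> p q" .
  with that marg mono supp show thesis unfolding q_def by blast
qed

section \<open>The two directions of the equivalence\<close>

text \<open>Both sides of the lifting dominate the embedded witness \<nu> and diverge from it by at
  most \<delta>. Since each dominates \<nu>, it can replace \<nu> as second argument of the
  divergence of the other.\<close>

lemma symmetric_lifting_of_witness:
  fixes \<mu> :: "('a \<times> 'b) spmf"
  assumes "set_spmf \<mu>1 \<subseteq> A1" and "set_spmf \<mu>2 \<subseteq> A2" and "R \<subseteq> A1 \<times> A2" and "\<epsilon> \<ge> 0"
    and le1: "\<And>a. spmf (map_spmf fst \<mu>) a \<le> spmf \<mu>1 a"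
    and le2: "\<And>b. spmf (map_spmf snd \<mu>) b \<le> spmf \<mu>2 b"
    and supp: "set_spmf \<mu> \<subseteq> R"
    and d1: "dp_div \<epsilon> \<mu>1 (map_spmf fst \<mu>) \<le> \<delta>"
    and d2: "dp_div \<epsilon> \<mu>2 (map_spmf snd \<mu>) \<le> \<delta>"
  shows "symmetric_lifting A1 A2 \<epsilon> \<delta> R \<mu>1 \<mu>2"
proof -
  define \<nu> where "\<nu> = map_spmf (map_prod Some Some) \<mu>"
  \<comment> \<open>Columns are treated as rows of the transpose, so \<open>complete_rows\<close>
    serves both sides.\<close>
  define \<nu>' where "\<nu>' = map_spmf prod.swap \<nu>"
  have fst_\<nu>: "map_spmf fst \<nu> = map_spmf Some (map_spmf fst \<mu>)"
    by (simp add: \<nu>_def spmf.map_comp o_def)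
  have fst_\<nu>': "map_spmf fst \<nu>' = map_spmf Some (map_spmf snd \<mu>)"
    by (simp add: \<nu>_def \<nu>'_def spmf.map_comp o_def)
  have Some_mono: "spmf (map_spmf Some p) x \<le> spmf (map_spmf Some p') x"
    if "\<And>a. spmf p a \<le> spmf p' a" for p p' :: "'c spmf" and x
    by (rule spmf_map_mono) (rule that)
  obtain L :: "('a option \<times> 'b option) spmf" where L: "map_spmf fst L = map_spmf Some \<mu>1"
    "\<And>z. spmf \<nu> z \<le> spmf L z"
    "set_spmf L \<subseteq> set_spmf \<nu> \<union> set_spmf (map_spmf Some \<mu>1) \<times> {None}"
    "dp_div \<epsilon> L \<nu> \<le> dp_div \<epsilon> (map_spmf Some \<mu>1) (map_spmf fst \<nu>)"
    using complete_rows[of \<nu> "map_spmf Some \<mu>1" \<epsilon> None] Some_mono[OF le1] \<open>\<epsilon> \<ge> 0\<close>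
    unfolding fst_\<nu> by blast
  obtain L' :: "('b option \<times> 'a option) spmf" where L': "map_spmf fst L' = map_spmf Some \<mu>2"
    "\<And>z. spmf \<nu>' z \<le> spmf L' z"
    "set_spmf L' \<subseteq> set_spmf \<nu>' \<union> set_spmf (map_spmf Some \<mu>2) \<times> {None}"
    "dp_div \<epsilon> L' \<nu>' \<le> dp_div \<epsilon> (map_spmf Some \<mu>2) (map_spmf fst \<nu>')"
    using complete_rows[of \<nu>' "map_spmf Some \<mu>2" \<epsilon> None] Some_mono[OF le2] \<open>\<epsilon> \<ge> 0\<close>
    unfolding fst_\<nu>' by blast
  define M where "M = map_spmf prod.swap L'"
  have \<nu>_swap: "\<nu> = map_spmf prod.swap \<nu>'" by (simp add: \<nu>'_def spmf.map_comp o_def)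
  have M_marg: "map_spmf snd M = map_spmf Some \<mu>2"
    by (simp add: M_def spmf.map_comp o_def flip: L'(1))
  have M_mono: "spmf \<nu> z \<le> spmf M z" for z
    unfolding M_def \<nu>_swap by (rule spmf_map_mono) (rule L'(2))
  have "dp_div \<epsilon> M \<nu> \<le> dp_div \<epsilon> L' \<nu>'" unfolding M_def \<nu>_swap by (rule dp_div_map_le)
  also note L'(4)
  also have "dp_div \<epsilon> (map_spmf Some \<mu>2) (map_spmf fst \<nu>') \<le> dp_div \<epsilon> \<mu>2 (map_spmf snd \<mu>)"
    unfolding fst_\<nu>' by (rule dp_div_map_le)
  finally have dM: "dp_div \<epsilon> M \<nu> \<le> \<delta>" using d2 by linarith
  have "dp_div \<epsilon> (map_spmf Some \<mu>1) (map_spmf fst \<nu>) \<le> dp_div \<epsilon> \<mu>1 (map_spmf fst \<mu>)"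
    unfolding fst_\<nu> by (rule dp_div_map_le)
  then have dL: "dp_div \<epsilon> L \<nu> \<le> \<delta>" using L(4) d1 by linarith
  \<comment> \<open>Enlarging the second argument only lowers the pointwise differences.\<close>
  have antimono: "dp_div \<epsilon> N N' \<le> dp_div \<epsilon> N \<nu>" if "\<And>z. spmf \<nu> z \<le> spmf N' z" for N N'
  proof (rule dp_div_mono_pos_part)
    fix z
    have "exp \<epsilon> * spmf \<nu> z \<le> exp \<epsilon> * spmf N' z" using that[of z] by simp
    then show "spmf N z - exp \<epsilon> * spmf N' z \<le> max 0 (spmf N z - exp \<epsilon> * spmf \<nu> z)" by linarith
  qed
  have \<nu>_supp: "set_spmf \<nu> \<subseteq> (\<lambda>(a, b). (Some a, Some b)) ` R"
    using supp by (force simp: \<nu>_def)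
  have "set_spmf L \<subseteq> star_rel A1 A2 R"
    using L(3) \<nu>_supp \<open>set_spmf \<mu>1 \<subseteq> A1\<close> unfolding star_rel_def set_map_spmf by blast
  moreover have "set_spmf M \<subseteq> star_rel A1 A2 R"
  proof -
    have "set_spmf M \<subseteq> set_spmf \<nu> \<union> {None} \<times> Some ` set_spmf \<mu>2"
      using L'(3) by (force simp: M_def \<nu>_swap)
    then show ?thesis
      using \<nu>_supp \<open>set_spmf \<mu>2 \<subseteq> A2\<close> unfolding star_rel_def by blast
  qed
  moreover have "star_rel A1 A2 R \<subseteq> star_set A1 \<times> star_set A2"
    using \<open>R \<subseteq> A1 \<times> A2\<close> by (auto simp: star_rel_def star_set_def)
  moreover have "dp_div \<epsilon> L M \<le> \<delta>" "dp_div \<epsilon> M L \<le> \<delta>"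
    using antimono[OF M_mono, of L] antimono[OF L(2), of M] dL dM by linarith+
  ultimately show ?thesis
    unfolding symmetric_lifting_def using L(1) M_marg by blast
qed

lemma witness_of_symmetric_lifting:
  fixes \<mu>1 :: "'a spmf" and \<mu>2 :: "'b spmf"
  assumes "symmetric_lifting A1 A2 \<epsilon> \<delta> R \<mu>1 \<mu>2" and "\<epsilon> \<ge> 0"
  obtains \<mu> :: "('a \<times> 'b) spmf"
  where "\<And>a. spmf (map_spmf fst \<mu>) a \<le> spmf \<mu>1 a"
    and "\<And>b. spmf (map_spmf snd \<mu>) b \<le> spmf \<mu>2 b"
    and "set_spmf \<mu> \<subseteq> R"
    and "dp_div \<epsilon> \<mu>1 (map_spmf fst \<mu>) \<le> \<delta>"
    and "dp_div \<epsilon> \<mu>2 (map_spmf snd \<mu>) \<le> \<delta>"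
proof -
  obtain L M :: "('a option \<times> 'b option) spmf" where
    marg: "map_spmf fst L = map_spmf Some \<mu>1" "map_spmf snd M = map_spmf Some \<mu>2"
    and supp: "set_spmf L \<union> set_spmf M \<subseteq> star_rel A1 A2 R"
    and d: "dp_div \<epsilon> L M \<le> \<delta>" "dp_div \<epsilon> M L \<le> \<delta>"
    using assms(1) unfolding symmetric_lifting_def by blast
  define \<nu> where "\<nu> = embed_spmf (\<lambda>z. min (spmf L z) (spmf M z))"
  \<comment> \<open>The minimum has no more mass than \<open>L\<close>, so \<open>embed_spmf\<close>
    represents it faithfully.\<close>
  have "(\<integral>\<^sup>+ z. ennreal (min (spmf L z) (spmf M z)) \<partial>count_space UNIV) \<le>
      (\<integral>\<^sup>+ z. ennreal (spmf L z) \<partial>count_space UNIV)"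
    by (intro nn_integral_mono ennreal_leI) simp
  also have "\<dots> \<le> 1" by (simp add: weight_spmf_le_1 flip: weight_spmf_eq_nn_integral_spmf)
  finally have \<nu>: "spmf \<nu> z = min (spmf L z) (spmf M z)" for z
    by (simp add: \<nu>_def)
  have \<nu>_le: "spmf \<nu> z \<le> spmf L z" "spmf \<nu> z \<le> spmf M z" for z by (simp_all add: \<nu>)
  have \<nu>_supp: "set_spmf \<nu> \<subseteq> (\<lambda>(a, b). (Some a, Some b)) ` R"
  proof
    fix z assume "z \<in> set_spmf \<nu>"
    then have z: "z \<in> set_spmf L" "z \<in> set_spmf M"
      using set_spmf_mono[of \<nu> L] set_spmf_mono[of \<nu> M] \<nu>_le by auto
    have "fst z \<in> set_spmf (map_spmf Some \<mu>1)" using z(1) by (simp flip: marg(1))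
    moreover have "snd z \<in> set_spmf (map_spmf Some \<mu>2)" using z(2) by (simp flip: marg(2))
    ultimately show "z \<in> (\<lambda>(a, b). (Some a, Some b)) ` R"
      using z(1) supp by (auto simp: star_rel_def)
  qed
  have dL: "dp_div \<epsilon> L \<nu> \<le> dp_div \<epsilon> L M" and dM: "dp_div \<epsilon> M \<nu> \<le> dp_div \<epsilon> M L"
  proof -
    \<comment> \<open>If \<open>u \<le> v\<close>, the left side is
      \<open>u - exp \<epsilon> * u\<close>, which is nonpositive; otherwise the minimum is
      \<open>v\<close>.\<close>
    have pos: "u - exp \<epsilon> * min u v \<le> max 0 (u - exp \<epsilon> * v)" if "0 \<le> u" for u v :: real
    proof (cases "u \<le> v")
      case True
      then show ?thesis using \<open>\<epsilon> \<ge> 0\<close> that mult_right_mono[of 1 "exp \<epsilon>" u] by simp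
    qed simp
    show "dp_div \<epsilon> L \<nu> \<le> dp_div \<epsilon> L M"
      by (rule dp_div_mono_pos_part) (simp only: \<nu> pos pmf_nonneg)
    show "dp_div \<epsilon> M \<nu> \<le> dp_div \<epsilon> M L"
      by (rule dp_div_mono_pos_part) (simp only: \<nu> pos pmf_nonneg min.commute[of "spmf L _"])
  qed
  \<comment> \<open>The unspecified value \<open>the None\<close> never matters here: by
    \<open>\<nu>_supp\<close>, \<nu> lives on pairs without stars, so this undoes the
    embedding.\<close>
  define \<mu> where "\<mu> = map_spmf (map_prod the the) \<nu>"
  have fst_\<mu>: "map_spmf fst \<mu> = map_spmf the (map_spmf fst \<nu>)"
    and snd_\<mu>: "map_spmf snd \<mu> = map_spmf the (map_spmf snd \<nu>)"
    by (simp_all add: \<mu>_def spmf.map_comp o_def)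
  \<comment> \<open>Writing \<mu>1 and \<mu>2 as push-forwards of \<open>L\<close> and
    \<open>M\<close> by the maps that send \<nu> to the marginals of \<mu> reduces the goals to
    monotonicity and data processing.\<close>
  have \<mu>1: "\<mu>1 = map_spmf the (map_spmf fst L)" and \<mu>2: "\<mu>2 = map_spmf the (map_spmf snd M)"
    unfolding marg by (rule map_spmf_the_Some[symmetric])+
  show thesis
  proof
    show "spmf (map_spmf fst \<mu>) a \<le> spmf \<mu>1 a" for a
      unfolding fst_\<mu> \<mu>1 by (intro spmf_map_mono \<nu>_le)
    show "spmf (map_spmf snd \<mu>) b \<le> spmf \<mu>2 b" for b
      unfolding snd_\<mu> \<mu>2 by (intro spmf_map_mono \<nu>_le)
    show "set_spmf \<mu> \<subseteq> R" using \<nu>_supp by (force simp: \<mu>_def)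
    show "dp_div \<epsilon> \<mu>1 (map_spmf fst \<mu>) \<le> \<delta>"
      unfolding fst_\<mu> \<mu>1 by (intro order_trans[OF dp_div_map_le] order_trans[OF dL] d)
    show "dp_div \<epsilon> \<mu>2 (map_spmf snd \<mu>) \<le> \<delta>"
      unfolding snd_\<mu> \<mu>2 by (intro order_trans[OF dp_div_map_le] order_trans[OF dM] d)
  qed
qed

theorem theorem5p36:
  fixes A1 :: "'a set" and A2 :: "'b set"
    and \<mu>1 :: "'a spmf" and \<mu>2 :: "'b spmf"
    and R :: "('a \<times> 'b) set" and \<epsilon> \<delta> :: real
  assumes "countable A1" and "countable A2"
    and "set_spmf \<mu>1 \<subseteq> A1" and "set_spmf \<mu>2 \<subseteq> A2"
    and "R \<subseteq> A1 \<times> A2"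
    and "\<epsilon> \<ge> 0"
  shows "(\<exists>\<mu> :: ('a \<times> 'b) spmf.
            set_spmf \<mu> \<subseteq> A1 \<times> A2 \<and>
            (\<forall>a\<in>A1. spmf (map_spmf fst \<mu>) a \<le> spmf \<mu>1 a) \<and>
            (\<forall>b\<in>A2. spmf (map_spmf snd \<mu>) b \<le> spmf \<mu>2 b) \<and>
            set_spmf \<mu> \<subseteq> R \<and>
            dp_div \<epsilon> \<mu>1 (map_spmf fst \<mu>) \<le> \<delta> \<and>
            dp_div \<epsilon> \<mu>2 (map_spmf snd \<mu>) \<le> \<delta>)
         \<longleftrightarrow> symmetric_lifting A1 A2 \<epsilon> \<delta> R \<mu>1 \<mu>2"
proof
  assume "\<exists>\<mu> :: ('a \<times> 'b) spmf.
            set_spmf \<mu> \<subseteq> A1 \<times> A2 \<and>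
            (\<forall>a\<in>A1. spmf (map_spmf fst \<mu>) a \<le> spmf \<mu>1 a) \<and>
            (\<forall>b\<in>A2. spmf (map_spmf snd \<mu>) b \<le> spmf \<mu>2 b) \<and>
            set_spmf \<mu> \<subseteq> R \<and>
            dp_div \<epsilon> \<mu>1 (map_spmf fst \<mu>) \<le> \<delta> \<and>
            dp_div \<epsilon> \<mu>2 (map_spmf snd \<mu>) \<le> \<delta>"
  then obtain \<mu> :: "('a \<times> 'b) spmf" where carrier: "set_spmf \<mu> \<subseteq> A1 \<times> A2"
    and le: "\<forall>a\<in>A1. spmf (map_spmf fst \<mu>) a \<le> spmf \<mu>1 a"
      "\<forall>b\<in>A2. spmf (map_spmf snd \<mu>) b \<le> spmf \<mu>2 b"
    and rest: "set_spmf \<mu> \<subseteq> R" "dp_div \<epsilon> \<mu>1 (map_spmf fst \<mu>) \<le> \<delta>"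
      "dp_div \<epsilon> \<mu>2 (map_spmf snd \<mu>) \<le> \<delta>"
    by blast
  \<comment> \<open>The witness is compared with \<mu>1 only on \<open>A1\<close>; off the carrier
    its marginal is 0, so the bound extends to the whole type.\<close>
  have "spmf (map_spmf fst \<mu>) a \<le> spmf \<mu>1 a" for a
  proof (cases "a \<in> A1")
    case False
    then have "spmf (map_spmf fst \<mu>) a = 0"
      using carrier by (intro spmf_map_outside) auto
    then show ?thesis by simp
  qed (use le in blast)
  moreover have "spmf (map_spmf snd \<mu>) b \<le> spmf \<mu>2 b" for b
  proof (cases "b \<in> A2")
    case False
    then have "spmf (map_spmf snd \<mu>) b = 0"
      using carrier by (intro spmf_map_outside) auto
    then show ?thesis by simp
  qed (use le in blast)
  ultimately show "symmetric_lifting A1 A2 \<epsilon> \<delta> R \<mu>1 \<mu>2"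
    using symmetric_lifting_of_witness[OF assms(3-6)] rest by blast
next
  assume "symmetric_lifting A1 A2 \<epsilon> \<delta> R \<mu>1 \<mu>2"
  then show "\<exists>\<mu> :: ('a \<times> 'b) spmf.
            set_spmf \<mu> \<subseteq> A1 \<times> A2 \<and>
            (\<forall>a\<in>A1. spmf (map_spmf fst \<mu>) a \<le> spmf \<mu>1 a) \<and>
            (\<forall>b\<in>A2. spmf (map_spmf snd \<mu>) b \<le> spmf \<mu>2 b) \<and>
            set_spmf \<mu> \<subseteq> R \<and>
            dp_div \<epsilon> \<mu>1 (map_spmf fst \<mu>) \<le> \<delta> \<and>
            dp_div \<epsilon> \<mu>2 (map_spmf snd \<mu>) \<le> \<delta>"
    using \<open>\<epsilon> \<ge> 0\<close> \<open>R \<subseteq> A1 \<times> A2\<close>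
    by (elim witness_of_symmetric_lifting) (blast intro: subset_trans)+
qed

end
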